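(* Consider the non-isomorphic linear orders $M=(\mathbb{R},<)$ and $N=(\mathbb{R}\setminus\{0\},<)$ as metric structures with the discrete metric. Then $L^1([0,1],M)\cong L^1([0,1],N)$, where $[0,1]$ is regarded as a probability measure space with the Lebesgue measure.
   Context: A discrete first-order structure is viewed as a metric structure with the discrete $\{0,1\}$-valued metric and $\{0,1\}$-valued predicates; here the language has a single binary predicate symbol $<$. For a probability space $(\Omega,\mu)$ and a metric structure $M$ in a language $\mathcal{L}$, a simple section is a function $\Omega\to M$ that is constant on each piece of a finite measurable partition of $\Omega$; a measurable section is a function $f:\Omega\to M$ that is $\mu$-a.e. the pointwise limit of a sequence of simple sections. $L^1(\Omega,M)$ is the set of measurable sections modulo a.e. equality, with metric $d(f,g)=\int_\Omega d^M(f(\omega),g(\omega))\,d\mu(\omega)$; it is an $\mathcal{L}$-structure in which a predicate symbol $R$ is interpreted by $R(\bar f)=\int_\Omega R^M(\bar f(\omega))\,d\mu(\omega)$. Isomorphisms of metric structures are surjective isometries preserving all symbols of the language. *)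

theory Defs
  imports "HOL-Analysis.Analysis"
begin

text \<open>Metric structures in the language with one binary predicate symbol, whose interpretation
  is real-valued. The fields are only meaningful on the carrier.\<close>

record 'a metric_structure =
  carrier :: "'a set"
  mdistance :: "'a \<Rightarrow> 'a \<Rightarrow> real"
  mless :: "'a \<Rightarrow> 'a \<Rightarrow> real"

definition discrete_structure :: "'a set \<Rightarrow> ('a \<Rightarrow> 'a \<Rightarrow> bool) \<Rightarrow> 'a metric_structure" where
  "discrete_structure A R =
     \<lparr>carrier = A,
      mdistance = (\<lambda>x y. if x = y then 0 else 1),
      mless = (\<lambda>x y. if R x y then 1 else 0)\<rparr>"

definition structure_iso ::
    "('a \<Rightarrow> 'b) \<Rightarrow> 'a metric_structure \<Rightarrow> 'b metric_structure \<Rightarrow> bool" where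
  "structure_iso h M N \<longleftrightarrow>
     h ` carrier M = carrier N \<and>
     (\<forall>x\<in>carrier M. \<forall>y\<in>carrier M. mdistance N (h x) (h y) = mdistance M x y) \<and>
     (\<forall>x\<in>carrier M. \<forall>y\<in>carrier M. mless N (h x) (h y) = mless M x y)"

definition isomorphic ::
    "'a metric_structure \<Rightarrow> 'b metric_structure \<Rightarrow> bool" where
  "isomorphic M N \<longleftrightarrow> (\<exists>h. structure_iso h M N)"

text \<open>Functions on a probability space are extensional, so that they are determined by their
  values on the space.\<close>

definition simple_section :: "'w measure \<Rightarrow> 'a metric_structure \<Rightarrow> ('w \<Rightarrow> 'a) \<Rightarrow> bool" where
  "simple_section P M f \<longleftrightarrow>
     f \<in> space P \<rightarrow>\<^sub>E carrier M \<and>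
     (\<exists>\<A>. finite \<A> \<and> \<A> \<subseteq> sets P \<and> partition_on (space P) \<A> \<and> (\<forall>A\<in>\<A>. f constant_on A))"

definition measurable_section :: "'w measure \<Rightarrow> 'a metric_structure \<Rightarrow> ('w \<Rightarrow> 'a) \<Rightarrow> bool" where
  "measurable_section P M f \<longleftrightarrow>
     f \<in> space P \<rightarrow>\<^sub>E carrier M \<and>
     (\<exists>s. (\<forall>n. simple_section P M (s n)) \<and>
          (AE \<omega> in P. (\<lambda>n. mdistance M (s n \<omega>) (f \<omega>)) \<longlonglongrightarrow> 0))"

definition ae_eq_rel :: "'w measure \<Rightarrow> 'a metric_structure \<Rightarrow> (('w \<Rightarrow> 'a) \<times> ('w \<Rightarrow> 'a)) set" where
  "ae_eq_rel P M =
     {(f, g). measurable_section P M f \<and> measurable_section P M g \<and> (AE \<omega> in P. f \<omega> = g \<omega>)}"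

text \<open>The elements are a.e.-equality classes of measurable sections, and the metric and the
  predicate are computed on chosen representatives. For a complete measure, such as Lebesgue
  measure on an interval, the integrands are measurable and the integrals do not depend on the
  choice. For an incomplete one they may fail to be measurable, and the Bochner integral is
  then 0 by convention, so the definition is intended for complete measures only.\<close>

definition L1 :: "'w measure \<Rightarrow> 'a metric_structure \<Rightarrow> ('w \<Rightarrow> 'a) set metric_structure" where
  "L1 P M =
     \<lparr>carrier = {f. measurable_section P M f} // ae_eq_rel P M,
      mdistance = (\<lambda>F G. \<integral>\<omega>. mdistance M ((SOME f. f \<in> F) \<omega>) ((SOME g. g \<in> G) \<omega>) \<partial>P),
      mless = (\<lambda>F G. \<integral>\<omega>. mless M ((SOME f. f \<in> F) \<omega>) ((SOME g. g \<in> G) \<omega>) \<partial>P)\<rparr>"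

end

theory Submission
  imports Defs
begin

text \<open>
  For every \<open>w\<close> the orders \<open>\<real> - {w}\<close> and \<open>\<real> - {0}\<close> are isomorphic. A measurable section of a
  discrete structure has countably many values up to a null set, so a section \<open>f\<close> of \<open>\<real>\<close> satisfies
  \<open>f w \<noteq> w\<close> for almost every \<open>w\<close>: over the point \<open>w\<close> the order \<open>\<real>\<close> may be replaced by \<open>\<real> - {w}\<close>.
  It remains to choose the isomorphisms \<open>\<real> - {w} \<cong> \<real> - {0}\<close> so that the image of each fixed point,
  in both directions, is a measurable function of \<open>w\<close> with countably many values. This is achieved
  by interpolating linearly between dyadic rationals that increase or decrease strictly to \<open>w\<close>.
\<close>

section \<open>Measurable sections of discrete structures\<close>

lemma simple_section_measurable:
  assumes "simple_section P M s"
  shows "s \<in> P \<rightarrow>\<^sub>M count_space UNIV" and "finite (s ` space P)"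
proof -
  obtain \<A> where \<A>: "finite \<A>" "\<A> \<subseteq> sets P" "partition_on (space P) \<A>" "\<forall>A\<in>\<A>. s constant_on A"
    using assms unfolding simple_section_def by blast
  then obtain v where v: "\<And>A x. A \<in> \<A> \<Longrightarrow> x \<in> A \<Longrightarrow> s x = v A"
    unfolding constant_on_def by metis
  have space: "space P = \<Union>\<A>"
    using \<A>(3) by (simp add: partition_on_def)
  show "s \<in> P \<rightarrow>\<^sub>M count_space UNIV"
  proof (rule measurableI)
    fix X
    have "s -` X \<inter> space P = \<Union>{A\<in>\<A>. v A \<in> X}"
      using v by (auto simp: space)
    also have "\<dots> \<in> sets P"
      using \<A>(1,2) by (intro sets.finite_Union) auto
    finally show "s -` X \<inter> space P \<in> sets P" .
  qed simp
  have "s ` space P \<subseteq> v ` \<A>"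
    using v by (auto simp: space)
  with \<A>(1) show "finite (s ` space P)"
    using finite_surj by blast
qed

lemma simple_section_discreteI:
  assumes f: "f \<in> space P \<rightarrow>\<^sub>E A" and meas: "f \<in> P \<rightarrow>\<^sub>M count_space UNIV"
    and fin: "finite (f ` space P)"
  shows "simple_section P (discrete_structure A R) f"
  unfolding simple_section_def
proof (intro conjI exI)
  let ?\<A> = "(\<lambda>c. f -` {c} \<inter> space P) ` f ` space P"
  show "f \<in> space P \<rightarrow>\<^sub>E carrier (discrete_structure A R)"
    using f by (simp add: discrete_structure_def)
  show "finite ?\<A>"
    using fin by blast
  show "?\<A> \<subseteq> sets P"
    using measurable_sets[OF meas] by auto
  show "partition_on (space P) ?\<A>"
    by (auto simp: partition_on_def disjoint_def)
  show "\<forall>A\<in>?\<A>. f constant_on A"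
    by (auto simp: constant_on_def)
qed

section \<open>Classes modulo a.e. equality and their chosen representatives\<close>

lemma equiv_ae_eq_rel: "equiv {f. measurable_section P K f} (ae_eq_rel P K)"
  unfolding equiv_def refl_on_def sym_def trans_def ae_eq_rel_def
  by (auto elim: AE_mp)

text \<open>\<open>L1\<close> computes its metric and predicate on representatives picked by
  \<open>SOME\<close>; this allows such a choice to be traded for a given \<open>f\<close> up to a
  null set.\<close>

lemma some_mem_ae_class:
  assumes "measurable_section P K f"
  shows "measurable_section P K (SOME g. g \<in> ae_eq_rel P K `` {f})"
    and "AE x in P. (SOME g. g \<in> ae_eq_rel P K `` {f}) x = f x"
proof -
  have "f \<in> ae_eq_rel P K `` {f}"
    using assms by (simp add: ae_eq_rel_def)
  then have "(SOME g. g \<in> ae_eq_rel P K `` {f}) \<in> ae_eq_rel P K `` {f}"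
    by (rule someI[of "\<lambda>g. g \<in> ae_eq_rel P K `` {f}"])
  then show "measurable_section P K (SOME g. g \<in> ae_eq_rel P K `` {f})"
    and "AE x in P. (SOME g. g \<in> ae_eq_rel P K `` {f}) x = f x"
    by (auto simp: ae_eq_rel_def eq_commute)
qed

lemma carrier_L1_some:
  assumes "X \<in> carrier (L1 P K)"
  shows "measurable_section P K (SOME f. f \<in> X)"
    and "X = ae_eq_rel P K `` {SOME f. f \<in> X}"
proof -
  obtain f where f: "measurable_section P K f" and X: "X = ae_eq_rel P K `` {f}"
    using assms by (auto simp: L1_def elim: quotientE)
  show "measurable_section P K (SOME f. f \<in> X)"
    unfolding X using f by (rule some_mem_ae_class)
  show "X = ae_eq_rel P K `` {SOME f. f \<in> X}"
    unfolding X using some_mem_ae_class[OF f] f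
    by (intro equiv_class_eq[OF equiv_ae_eq_rel]) (auto simp: ae_eq_rel_def eq_commute)
qed

section \<open>Sections over a complete measure space\<close>

context complete_measure
begin

text \<open>Up to a null set, the preimage of \<open>X\<close> is the union of the countably many
  level sets over \<open>C \<inter> X\<close>; completeness absorbs the null set.\<close>

lemma measurable_AE_countable:
  assumes C: "countable C" "AE x in M. f x \<in> C"
    and level: "\<And>c. c \<in> C \<Longrightarrow> {x \<in> space M. f x = c} \<in> sets M"
  shows "f \<in> M \<rightarrow>\<^sub>M count_space UNIV"
proof (rule measurableI)
  fix X
  show "f -` X \<inter> space M \<in> sets M"
  proof (rule in_sets_AE)
    show "(\<Union>c\<in>C \<inter> X. {x \<in> space M. f x = c}) \<in> sets M"
      using C(1) level by (intro sets.countable_UN') auto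
    show "AE x in M. x \<in> (\<Union>c\<in>C \<inter> X. {x \<in> space M. f x = c}) \<longleftrightarrow> x \<in> f -` X \<inter> space M"
      using C(2) by eventually_elim auto
  qed simp
qed simp

text \<open>Convergence in a discrete metric is eventual equality, so a limit of simple sections
  a.e. takes only values of those finitely-valued functions. Conversely, a function with countably
  many values is the limit of its truncations to finitely many of them.\<close>

lemma measurable_section_discrete_iff:
  "measurable_section M (discrete_structure A R) f \<longleftrightarrow>
     f \<in> space M \<rightarrow>\<^sub>E A \<and> f \<in> M \<rightarrow>\<^sub>M count_space UNIV \<and>
     (\<exists>C. countable C \<and> (AE x in M. f x \<in> C))"
proof safe
  assume "measurable_section M (discrete_structure A R) f"
  then obtain s where f: "f \<in> space M \<rightarrow>\<^sub>E A"
    and s: "\<And>n. simple_section M (discrete_structure A R) (s n)"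
    and lim: "AE x in M. (\<lambda>n. mdistance (discrete_structure A R) (s n x) (f x)) \<longlonglongrightarrow> 0"
    unfolding measurable_section_def by (auto simp: discrete_structure_def)
  have stab: "AE x in M. \<forall>\<^sub>F n in sequentially. s n x = f x"
    using lim
  proof eventually_elim
    case (elim x)
    then have "\<forall>\<^sub>F n in sequentially. mdistance (discrete_structure A R) (s n x) (f x) < 1"
      by (rule order_tendstoD) simp
    then show ?case
      by eventually_elim (simp add: discrete_structure_def split: if_splits)
  qed
  let ?C = "\<Union>n. s n ` space M"
  have C: "countable ?C"
    using simple_section_measurable(2)[OF s] by (intro countable_UN[OF _ countable_finite]) auto
  have f_C: "AE x in M. f x \<in> ?C"
    using stab AE_space
  proof eventually_elim
    case (elim x)
    then obtain n where "s n x = f x"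
      unfolding eventually_sequentially by blast
    then show ?case
      using elim(2) by (metis UNIV_I UN_I image_eqI)
  qed
  show "f x \<in> A" if "x \<in> space M" for x
    using f that by blast
  show "f x = undefined" if "x \<notin> space M" for x
    using f that by blast
  show "\<exists>C. countable C \<and> (AE x in M. f x \<in> C)"
    using C f_C by blast
  show "f \<in> M \<rightarrow>\<^sub>M count_space UNIV"
  proof (rule measurable_AE_countable[OF C f_C])
    fix c
    have [measurable]: "s n \<in> M \<rightarrow>\<^sub>M count_space UNIV" for n
      by (rule simple_section_measurable(1)[OF s])
    show "{x \<in> space M. f x = c} \<in> sets M"
    \<comment> \<open>Where \<open>s n x\<close> is eventually \<open>f x\<close>, having
      \<open>f x = c\<close> is the same as having \<open>s n x = c\<close> eventually, a condition
      on countably many measurable functions.\<close>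
    proof (rule in_sets_AE)
      show "{x \<in> space M. \<forall>\<^sub>F n in sequentially. s n x = c} \<in> sets M"
        unfolding eventually_sequentially by measurable
      show "AE x in M. x \<in> {x \<in> space M. \<forall>\<^sub>F n in sequentially. s n x = c} \<longleftrightarrow>
          x \<in> {x \<in> space M. f x = c}"
        using stab
      proof eventually_elim
        case (elim x)
        have "(\<forall>\<^sub>F n in sequentially. s n x = c) \<longleftrightarrow> (\<forall>\<^sub>F n in sequentially. f x = c)"
          using elim by (intro eventually_subst) (auto elim: eventually_mono)
        then show ?case
          by simp
      qed
    qed simp
  qed
next
  fix C
  assume f: "f \<in> space M \<rightarrow>\<^sub>E A" and meas [measurable]: "f \<in> M \<rightarrow>\<^sub>M count_space UNIV"
    and C: "countable C" "AE x in M. f x \<in> C"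
  show "measurable_section M (discrete_structure A R) f"
  \<comment> \<open>Over an empty space \<open>A\<close> may be empty too and offer no default value
    for truncation; \<open>f\<close> is then itself simple.\<close>
  proof (cases "space M = {}")
    case True
    then have "simple_section M (discrete_structure A R) f"
      using f meas by (intro simple_section_discreteI) auto
    then show ?thesis
      using f unfolding measurable_section_def
      by (intro conjI exI[of _ "\<lambda>_. f"]) (auto simp: discrete_structure_def)
  next
    case False
    then obtain a where a: "a \<in> A"
      using f by blast
    \<comment> \<open>\<open>s n\<close> keeps the values with index at most \<open>n\<close> in an
      enumeration of \<open>C\<close> and replaces all others by the default
      \<open>a\<close>.\<close>
    define s where "s n = (\<lambda>x\<in>space M. if f x \<in> from_nat_into C ` {..n} then f x else a)" for n
    have "simple_section M (discrete_structure A R) (s n)" for n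
    proof (rule simple_section_discreteI)
      show "s n \<in> space M \<rightarrow>\<^sub>E A"
        using f a by (auto simp: s_def)
      show "s n \<in> M \<rightarrow>\<^sub>M count_space UNIV"
        by (subst measurable_cong[where g = "\<lambda>x. if f x \<in> from_nat_into C ` {..n} then f x else a"])
          (auto simp: s_def intro: measurable_compose[OF meas])
      have "s n ` space M \<subseteq> insert a (from_nat_into C ` {..n})"
        by (auto simp: s_def)
      then show "finite (s n ` space M)"
        by (rule finite_subset) simp
    qed
    moreover have "AE x in M. (\<lambda>n. mdistance (discrete_structure A R) (s n x) (f x)) \<longlonglongrightarrow> 0"
      using C(2) AE_space
    proof eventually_elim
      case (elim x)
      then obtain k where k: "f x = from_nat_into C k"
        using C(1) by (metis from_nat_into_surj)
      have "s n x = f x" if "k \<le> n" for n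
        using elim(2) that by (auto simp: s_def k)
      then have "\<forall>\<^sub>F n in sequentially. mdistance (discrete_structure A R) (s n x) (f x) = 0"
        by (intro eventually_sequentiallyI[of k]) (simp add: discrete_structure_def)
      then show ?case
        by (rule tendsto_eventually)
    qed
    ultimately show ?thesis
      using f unfolding measurable_section_def by (auto simp: discrete_structure_def)
  qed
qed

text \<open>The null set for \<open>Q c\<close> depends on \<open>c\<close>, but \<open>f\<close>
  essentially meets only countably many \<open>c\<close>, so these null sets combine into one. Thus
  a.e. statements about constants pass to all sections.\<close>

lemma AE_comp_countable:
  assumes f: "measurable_section M (discrete_structure A R) f"
    and Q: "\<And>c. c \<in> A \<Longrightarrow> AE x in M. Q c x"
  shows "AE x in M. Q (f x) x"
proof -
  obtain C where C: "countable C" "AE x in M. f x \<in> C" and f: "f \<in> space M \<rightarrow>\<^sub>E A"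
    using f unfolding measurable_section_discrete_iff by blast
  have "AE x in M. \<forall>c\<in>C \<inter> A. Q c x"
    using C(1) Q by (subst AE_ball_countable) auto
  with C(2) AE_space show ?thesis
    by eventually_elim (use f in auto)
qed

text \<open>\<open>F c\<close> is the intended image of the constant section \<open>c\<close>.
  Gluing these images along the countably many values of \<open>f\<close> leaves countably many
  values, and each level set is a.e. a countable union of sets where \<open>f x = c\<close> and
  \<open>F c x = d\<close>.\<close>

lemma measurable_section_comp:
  assumes f: "measurable_section M (discrete_structure A R) f"
    and F: "\<And>c. c \<in> A \<Longrightarrow> measurable_section M (discrete_structure B S) (F c)"
  shows "measurable_section M (discrete_structure B S) (\<lambda>x\<in>space M. F (f x) x)"
proof -
  obtain C where C: "countable C" "AE x in M. f x \<in> C" and f_A: "f \<in> space M \<rightarrow>\<^sub>E A"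
    and [measurable]: "f \<in> M \<rightarrow>\<^sub>M count_space UNIV"
    using f unfolding measurable_section_discrete_iff by blast
  have F_B: "F c \<in> space M \<rightarrow>\<^sub>E B" and F_meas: "F c \<in> M \<rightarrow>\<^sub>M count_space UNIV"
    and "\<exists>D. countable D \<and> (AE x in M. F c x \<in> D)" if "c \<in> A" for c
    using F[OF that] unfolding measurable_section_discrete_iff by auto
  then obtain D where D: "\<And>c. c \<in> A \<Longrightarrow> countable (D c)"
      "\<And>c. c \<in> A \<Longrightarrow> AE x in M. F c x \<in> D c"
    by metis
  let ?g = "\<lambda>x\<in>space M. F (f x) x" and ?D = "\<Union>c\<in>C \<inter> A. D c"
  have cD: "countable ?D"
    using C(1) D(1) by auto
  have "AE x in M. F (f x) x \<in> D (f x)"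
    using D(2) by (rule AE_comp_countable[OF f])
  with C(2) AE_space have gD: "AE x in M. ?g x \<in> ?D"
    by eventually_elim (use f_A in auto)
  have "?g \<in> M \<rightarrow>\<^sub>M count_space UNIV"
  proof (rule measurable_AE_countable[OF cD gD])
    fix d
    show "{x \<in> space M. ?g x = d} \<in> sets M"
    proof (rule in_sets_AE)
      have "{x \<in> space M. f x = c \<and> F c x = d} \<in> sets M" if "c \<in> A" for c
      proof -
        note [measurable] = F_meas[OF that]
        show ?thesis by measurable
      qed
      then show "(\<Union>c\<in>C \<inter> A. {x \<in> space M. f x = c \<and> F c x = d}) \<in> sets M"
        using C(1) by (intro sets.countable_UN') auto
      show "AE x in M. x \<in> (\<Union>c\<in>C \<inter> A. {x \<in> space M. f x = c \<and> F c x = d}) \<longleftrightarrow>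
          x \<in> {x \<in> space M. ?g x = d}"
        using C(2) by eventually_elim (use f_A in auto)
    qed simp
  qed
  moreover have "?g \<in> space M \<rightarrow>\<^sub>E B"
    using f_A F_B by fastforce
  ultimately show ?thesis
    unfolding measurable_section_discrete_iff using cD gD by blast
qed

section \<open>From a.e. isomorphisms on constants to isomorphisms of \<open>L1\<close>\<close>

text \<open>The pair of the two sections again has countably many values a.e., hence is measurable
  into the discrete sigma-algebra, on which every real function is measurable. This supplies the
  measurability needed to compare integrals.\<close>

lemma borel_measurable_section_pair:
  fixes k :: "'b \<Rightarrow> 'c \<Rightarrow> real"
  assumes f: "measurable_section M (discrete_structure A R) f"
    and g: "measurable_section M (discrete_structure B S) g"
  shows "(\<lambda>x. k (f x) (g x)) \<in> borel_measurable M"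
proof -
  obtain C D where C: "countable C" "AE x in M. f x \<in> C" and D: "countable D" "AE x in M. g x \<in> D"
    and [measurable]: "f \<in> M \<rightarrow>\<^sub>M count_space UNIV" "g \<in> M \<rightarrow>\<^sub>M count_space UNIV"
    using f g unfolding measurable_section_discrete_iff by blast
  have "(\<lambda>x. (f x, g x)) \<in> M \<rightarrow>\<^sub>M count_space UNIV"
  proof (rule measurable_AE_countable)
    show "countable (C \<times> D)"
      using C(1) D(1) by blast
    show "AE x in M. (f x, g x) \<in> C \<times> D"
      using C(2) D(2) by eventually_elim simp
    show "{x \<in> space M. (f x, g x) = c} \<in> sets M" for c
      by (cases c) simp
  qed
  then have "(\<lambda>x. case_prod k (f x, g x)) \<in> borel_measurable M"
    by (rule measurable_compose) simp
  then show ?thesis by simp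
qed

text \<open>All assumptions concern constants, at most two at a time, with null sets that may depend
  on them; \<open>AE_comp_countable\<close> extends them to sections. The isomorphism sends the
  class of \<open>f\<close> to that of \<open>x \<mapsto> F (f x) x\<close>, and \<open>G\<close>
  provides preimages.\<close>

lemma isomorphic_L1_discreteI:
  assumes F: "\<And>a. a \<in> A \<Longrightarrow> measurable_section M (discrete_structure B S) (F a)"
    and G: "\<And>b. b \<in> B \<Longrightarrow> measurable_section M (discrete_structure A R) (G b)"
    and FG: "\<And>b. b \<in> B \<Longrightarrow> AE x in M. F (G b x) x = b"
    and inj: "\<And>a a'. a \<in> A \<Longrightarrow> a' \<in> A \<Longrightarrow> AE x in M. F a x = F a' x \<longleftrightarrow> a = a'"
    and rel: "\<And>a a'. a \<in> A \<Longrightarrow> a' \<in> A \<Longrightarrow> AE x in M. S (F a x) (F a' x) \<longleftrightarrow> R a a'"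
  shows "isomorphic (L1 M (discrete_structure A R)) (L1 M (discrete_structure B S))"
proof -
  let ?A = "discrete_structure A R" and ?B = "discrete_structure B S"
  define \<Phi> where "\<Phi> f = (\<lambda>x\<in>space M. F (f x) x)" for f
  define h where "h X = ae_eq_rel M ?B `` {\<Phi> (SOME f. f \<in> X)}" for X
  have \<Phi>: "measurable_section M ?B (\<Phi> f)" if "measurable_section M ?A f" for f
    unfolding \<Phi>_def using that F by (rule measurable_section_comp)
  have \<Phi>_eq: "AE x in M. \<Phi> f x = F (f x) x" for f
    using AE_space by eventually_elim (simp add: \<Phi>_def)
  \<comment> \<open>\<open>h\<close> is defined through a chosen representative; its value can be
    computed from any other one.\<close>
  have h_eq: "h (ae_eq_rel M ?A `` {f}) = ae_eq_rel M ?B `` {g}"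
    if f: "measurable_section M ?A f" and g: "measurable_section M ?B g"
      and eq: "AE x in M. F (f x) x = g x" for f g
  proof -
    let ?f = "SOME f'. f' \<in> ae_eq_rel M ?A `` {f}"
    have "AE x in M. \<Phi> ?f x = g x"
      using \<Phi>_eq[of ?f] some_mem_ae_class(2)[OF f] eq by eventually_elim simp
    then show ?thesis
      unfolding h_def using g \<Phi>[OF some_mem_ae_class(1)[OF f]]
      by (intro equiv_class_eq[OF equiv_ae_eq_rel]) (simp add: ae_eq_rel_def)
  qed
  have surj: "h ` carrier (L1 M ?A) = carrier (L1 M ?B)"
  proof (intro equalityI subsetI)
    fix Y assume "Y \<in> h ` carrier (L1 M ?A)"
    then show "Y \<in> carrier (L1 M ?B)"
      using \<Phi>[OF carrier_L1_some(1)] by (auto simp: h_def L1_def intro!: quotientI)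
  next
    fix Y assume "Y \<in> carrier (L1 M ?B)"
    then obtain g where g: "measurable_section M ?B g" and Y: "Y = ae_eq_rel M ?B `` {g}"
      by (auto dest: carrier_L1_some)
    let ?f = "\<lambda>x\<in>space M. G (g x) x"
    have f: "measurable_section M ?A ?f"
      using g G by (rule measurable_section_comp)
    have "AE x in M. F (G (g x) x) x = g x"
      using g FG by (rule AE_comp_countable)
    with AE_space have "AE x in M. F (?f x) x = g x"
      by eventually_elim simp
    then have "Y = h (ae_eq_rel M ?A `` {?f})"
      using h_eq[OF f g] Y by simp
    then show "Y \<in> h ` carrier (L1 M ?A)"
      using f by (auto simp: L1_def intro!: quotientI)
  qed
  \<comment> \<open>With \<open>k\<close> and \<open>l\<close> arbitrary, one argument serves both
    the metric and the predicate.\<close>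
  have integral_h: "(\<integral>x. k ((SOME g. g \<in> h X) x) ((SOME g. g \<in> h Y) x) \<partial>M) =
      (\<integral>x. l ((SOME f. f \<in> X) x) ((SOME f. f \<in> Y) x) \<partial>M)"
    if X: "X \<in> carrier (L1 M ?A)" and Y: "Y \<in> carrier (L1 M ?A)"
      and kl: "\<And>a a'. a \<in> A \<Longrightarrow> a' \<in> A \<Longrightarrow> AE x in M. k (F a x) (F a' x) = l a a'"
    for X Y and k :: "_ \<Rightarrow> _ \<Rightarrow> real" and l
  proof (rule integral_cong_AE)
    let ?f = "SOME f. f \<in> X" and ?g = "SOME f. f \<in> Y"
    have f: "measurable_section M ?A ?f" and g: "measurable_section M ?A ?g"
      using X Y by (auto intro: carrier_L1_some)
    note hX = some_mem_ae_class[OF \<Phi>[OF f], folded h_def]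
    note hY = some_mem_ae_class[OF \<Phi>[OF g], folded h_def]
    show "(\<lambda>x. k ((SOME g. g \<in> h X) x) ((SOME g. g \<in> h Y) x)) \<in> borel_measurable M"
      by (rule borel_measurable_section_pair[OF hX(1) hY(1)])
    show "(\<lambda>x. l (?f x) (?g x)) \<in> borel_measurable M"
      by (rule borel_measurable_section_pair[OF f g])
    \<comment> \<open>The two constants in \<open>kl\<close> are replaced by sections one after the
      other.\<close>
    have "AE x in M. k (F (?f x) x) (F (?g x) x) = l (?f x) (?g x)"
      by (rule AE_comp_countable[OF f], rule AE_comp_countable[OF g], rule kl)
    with hX(2) hY(2) \<Phi>_eq[of ?f] \<Phi>_eq[of ?g]
    show "AE x in M. k ((SOME g. g \<in> h X) x) ((SOME g. g \<in> h Y) x) = l (?f x) (?g x)"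
      by eventually_elim simp
  qed
  have "structure_iso h (L1 M ?A) (L1 M ?B)"
    unfolding structure_iso_def
  proof (intro conjI ballI surj)
    fix X Y assume XY: "X \<in> carrier (L1 M ?A)" "Y \<in> carrier (L1 M ?A)"
    have "AE x in M. mdistance ?B (F a x) (F a' x) = mdistance ?A a a'"
      if "a \<in> A" "a' \<in> A" for a a'
      using inj[OF that] by eventually_elim (simp add: discrete_structure_def)
    from integral_h[where k = "mdistance ?B" and l = "mdistance ?A", OF XY this]
    show "mdistance (L1 M ?B) (h X) (h Y) = mdistance (L1 M ?A) X Y"
      by (simp add: L1_def)
    have "AE x in M. mless ?B (F a x) (F a' x) = mless ?A a a'"
      if "a \<in> A" "a' \<in> A" for a a'
      using rel[OF that] by eventually_elim (simp add: discrete_structure_def)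
    from integral_h[where k = "mless ?B" and l = "mless ?A", OF XY this]
    show "mless (L1 M ?B) (h X) (h Y) = mless (L1 M ?A) X Y"
      by (simp add: L1_def)
  qed
  then show ?thesis
    unfolding isomorphic_def by blast
qed

end

section \<open>Isomorphisms between the punctured lines\<close>

text \<open>The piecewise linear function through the points \<open>(n, a n)\<close>, continued to
  the left of 0 with slope 1. If \<open>a\<close> increases strictly to \<open>l\<close>, it is an
  order isomorphism from the line onto the open ray below \<open>l\<close>.\<close>

definition interp :: "(nat \<Rightarrow> real) \<Rightarrow> real \<Rightarrow> real" where
  "interp a t = (if t < 0 then a 0 + t
     else a (nat \<lfloor>t\<rfloor>) + frac t * (a (Suc (nat \<lfloor>t\<rfloor>)) - a (nat \<lfloor>t\<rfloor>)))"

lemma interp_nonneg_bounds: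
  assumes "strict_mono a" "0 \<le> t"
  shows "a (nat \<lfloor>t\<rfloor>) \<le> interp a t" "interp a t < a (Suc (nat \<lfloor>t\<rfloor>))"
proof -
  let ?n = "nat \<lfloor>t\<rfloor>"
  have d: "0 < a (Suc ?n) - a ?n"
    using assms(1) by (simp add: strict_mono_Suc_iff)
  have "0 \<le> frac t * (a (Suc ?n) - a ?n)" "frac t * (a (Suc ?n) - a ?n) < 1 * (a (Suc ?n) - a ?n)"
    using d frac_lt_1[of t] by (auto intro!: mult_nonneg_nonneg mult_strict_right_mono)
  then show "a ?n \<le> interp a t" "interp a t < a (Suc ?n)"
    using assms(2) by (auto simp: interp_def)
qed

lemma strict_mono_interp:
  assumes "strict_mono a"
  shows "strict_mono (interp a)"
proof (rule strict_monoI)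
  fix s t :: real assume st: "s < t"
  consider "t < 0" | "s < 0" "0 \<le> t" | "0 \<le> s" "\<lfloor>s\<rfloor> = \<lfloor>t\<rfloor>" | "0 \<le> s" "\<lfloor>s\<rfloor> < \<lfloor>t\<rfloor>"
    using st floor_mono[of s t] by linarith
  then show "interp a s < interp a t"
  proof cases
    case 1
    then show ?thesis using st by (simp add: interp_def)
  next
    case 2
    have "interp a s < a 0"
      using 2 by (simp add: interp_def)
    also have "a 0 \<le> a (nat \<lfloor>t\<rfloor>)"
      using assms by (simp add: strict_mono_less_eq)
    also have "\<dots> \<le> interp a t"
      using assms 2 by (intro interp_nonneg_bounds)
    finally show ?thesis .
  next
    case 3
    then have "frac s < frac t"
      using st by (simp add: frac_def)
    moreover have "0 < a (Suc (nat \<lfloor>t\<rfloor>)) - a (nat \<lfloor>t\<rfloor>)"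
      using assms by (simp add: strict_mono_Suc_iff)
    ultimately show ?thesis
      using 3 st by (simp add: interp_def)
  next
    case 4
    then have "Suc (nat \<lfloor>s\<rfloor>) \<le> nat \<lfloor>t\<rfloor>"
      by linarith
    have "interp a s < a (Suc (nat \<lfloor>s\<rfloor>))"
      using assms 4 by (intro interp_nonneg_bounds)
    also have "\<dots> \<le> a (nat \<lfloor>t\<rfloor>)"
      using assms \<open>Suc (nat \<lfloor>s\<rfloor>) \<le> nat \<lfloor>t\<rfloor>\<close> by (simp add: strict_mono_less_eq)
    also have "\<dots> \<le> interp a t"
      using assms 4 st by (intro interp_nonneg_bounds) auto
    finally show ?thesis .
  qed
qed

lemma interp_less_limit:
  assumes "strict_mono a" "\<And>n. a n < l"
  shows "interp a t < l"
proof (cases "t < 0")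
  case True
  then show ?thesis using assms(2)[of 0] by (simp add: interp_def)
next
  case False
  then show ?thesis
    using interp_nonneg_bounds(2)[OF assms(1)] assms(2) by (meson less_trans not_less)
qed

lemma interp_surj:
  assumes "strict_mono a" "x < a m"
  shows "\<exists>t. interp a t = x"
proof (cases "x < a 0")
  case True
  then show ?thesis by (intro exI[of _ "x - a 0"]) (simp add: interp_def)
next
  case False
  \<comment> \<open>The linear piece that reaches \<open>x\<close> ends at the first node above
    \<open>x\<close>; this is not node 0 because \<open>a 0 \<le> x\<close>.\<close>
  define k where "k = (LEAST k. x < a k)"
  have "x < a k"
    unfolding k_def using assms(2) by (rule LeastI)
  then obtain n where k: "k = Suc n"
    using False by (cases k) auto
  have n: "a n \<le> x" "x < a (Suc n)"
    using not_less_Least[of n "\<lambda>k. x < a k"] \<open>x < a k\<close> k by (auto simp: k_def not_less)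
  define r where "r = (x - a n) / (a (Suc n) - a n)"
  have r: "0 \<le> r" "r < 1"
    using n by (auto simp: r_def)
  have "\<lfloor>real n + r\<rfloor> = int n"
    using r by linarith
  then have "interp a (real n + r) = a n + r * (a (Suc n) - a n)"
    using r by (simp add: interp_def frac_def)
  also have "\<dots> = x"
    using n by (simp add: r_def)
  finally show ?thesis by blast
qed

text \<open>Only the two neighbouring nodes enter into \<open>interp a t\<close>, so rational nodes leave countably many
  possibilities for the value, and likewise for the argument.\<close>

lemma countable_interp_values:
  "countable {interp a t |a. range a \<subseteq> \<rat>}"
proof (rule countable_subset)
  show "{interp a t |a. range a \<subseteq> \<rat>} \<subseteq>
      (\<lambda>p. p + t) ` \<rat> \<union> (\<lambda>(p, q). p + frac t * (q - p)) ` (\<rat> \<times> \<rat>)"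
    by (fastforce simp: interp_def)
  show "countable ((\<lambda>p. p + t) ` \<rat> \<union> (\<lambda>(p, q). p + frac t * (q - p)) ` (\<rat> \<times> \<rat>))"
    by (intro countable_Un countable_image countable_SIGMA countable_rat)
qed

lemma countable_interp_arguments:
  "countable {t. \<exists>a. strict_mono a \<and> range a \<subseteq> \<rat> \<and> interp a t = x}"
proof (rule countable_subset)
  \<comment> \<open>The first image solves \<open>interp a t = x\<close> on the left branch with
    \<open>p = a 0\<close>, the second on the piece from node \<open>n\<close> to its successor with
    values \<open>p\<close> and \<open>q\<close>.\<close>
  let ?D = "(\<lambda>p. x - p) ` \<rat> \<union> (\<lambda>(n, p, q). real n + (x - p) / (q - p)) ` (UNIV \<times> \<rat> \<times> \<rat>)"
  show "countable ?D"
    by (intro countable_Un countable_image countable_SIGMA countable_rat) auto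
  show "{t. \<exists>a. strict_mono a \<and> range a \<subseteq> \<rat> \<and> interp a t = x} \<subseteq> ?D"
  proof safe
    fix t and a :: "nat \<Rightarrow> real"
    assume a: "strict_mono a" "range a \<subseteq> \<rat>"
      and "x = interp a t"
      and "t \<notin> (\<lambda>(n, p, q). real n + (interp a t - p) / (q - p)) ` (UNIV \<times> \<rat> \<times> \<rat>)"
    let ?n = "nat \<lfloor>t\<rfloor>"
    have "t < 0"
    proof (rule ccontr)
      assume "\<not> t < 0"
      moreover have "a ?n < a (Suc ?n)"
        using a(1) by (simp add: strict_mono_Suc_iff)
      ultimately have "t = real ?n + (interp a t - a ?n) / (a (Suc ?n) - a ?n)"
        by (simp add: interp_def frac_def)
      then have "t = (\<lambda>(n, p, q). real n + (interp a t - p) / (q - p)) (?n, a ?n, a (Suc ?n))"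
        by simp
      moreover have "(?n, a ?n, a (Suc ?n)) \<in> UNIV \<times> \<rat> \<times> \<rat>"
        using a(2) by auto
      ultimately show False
        using \<open>t \<notin> _\<close> by blast
    qed
    then show "t \<in> (\<lambda>p. interp a t - p) ` \<rat>"
      using a(2) by (intro image_eqI[of _ _ "a 0"]) (auto simp: interp_def)
  qed
qed

section \<open>Dyadic approximation from below\<close>

text \<open>Subtracting 1 after rounding down makes the sequence strictly increasing and keeps it
  strictly below \<open>w\<close>, even when \<open>w\<close> is dyadic.\<close>

definition dyadic_below :: "real \<Rightarrow> nat \<Rightarrow> real" where
  "dyadic_below w n = (of_int \<lfloor>2 ^ n * w\<rfloor> - 1) / 2 ^ n"

lemma strict_mono_dyadic_below: "strict_mono (dyadic_below w)"
proof (unfold strict_mono_Suc_iff, rule)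
  fix n
  have "2 * \<lfloor>2 ^ n * w\<rfloor> \<le> \<lfloor>2 ^ Suc n * w\<rfloor>"
    by (simp add: le_floor_iff mult.assoc)
  \<comment> \<open>Doubling turns the offset 1 into 2, which is what makes the inequality
    strict.\<close>
  then have "2 * (of_int \<lfloor>2 ^ n * w\<rfloor> - 1) < (of_int \<lfloor>2 ^ Suc n * w\<rfloor> - 1 :: real)"
    by simp
  then have "2 * (of_int \<lfloor>2 ^ n * w\<rfloor> - 1) / 2 ^ Suc n <
      (of_int \<lfloor>2 ^ Suc n * w\<rfloor> - 1) / (2 ^ Suc n :: real)"
    by (rule divide_strict_right_mono) simp
  then show "dyadic_below w n < dyadic_below w (Suc n)"
    by (simp only: dyadic_below_def power_Suc mult_divide_mult_cancel_left_if) simp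
qed

lemma dyadic_below_less: "dyadic_below w n < w"
proof -
  have "of_int \<lfloor>2 ^ n * w\<rfloor> - 1 < 2 ^ n * w"
    by linarith
  then show ?thesis
    by (simp add: dyadic_below_def field_simps)
qed

lemma dyadic_below_exceeds:
  assumes "x < w"
  shows "\<exists>n. x < dyadic_below w n"
proof -
  \<comment> \<open>Rounding and the offset together lower \<open>w\<close> by less than
    \<open>2 / 2 ^ n\<close>.\<close>
  obtain n where "2 / (w - x) < 2 ^ n"
    using real_arch_pow[of 2] by auto
  then have "2 ^ n * x < 2 ^ n * w - 2"
    using assms by (simp add: field_simps)
  then have "2 ^ n * x < of_int \<lfloor>2 ^ n * w\<rfloor> - 1"
    by linarith
  then have "x < dyadic_below w n"
    by (simp add: dyadic_below_def field_simps)
  then show ?thesis ..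
qed

lemma dyadic_below_rat: "range (dyadic_below w) \<subseteq> \<rat>"
  by (auto simp: dyadic_below_def)

lemma interp_dyadic_measurable [measurable]:
  "(\<lambda>w. interp (dyadic_below w) t) \<in> borel_measurable borel"
  unfolding interp_def dyadic_below_def by measurable

section \<open>The isomorphisms opening a gap at \<open>w\<close>, and their inverses\<close>

text \<open>Off 0 this is an order isomorphism onto the line without \<open>w\<close>. The map
  \<open>y \<mapsto> - ln (- y)\<close> stretches the negative ray to the whole line, which
  \<open>interp\<close> carries to the ray below \<open>w\<close>; the positive ray is treated by
  reflection, with nodes below \<open>- w\<close>. The value at 0 is meaningless.\<close>

definition split_line :: "real \<Rightarrow> real \<Rightarrow> real" where
  "split_line w y = (if y < 0 then interp (dyadic_below w) (- ln (- y))
     else - interp (dyadic_below (- w)) (- ln y))"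

lemma split_line_neg: "y < 0 \<Longrightarrow> split_line w y < w"
  by (simp add: split_line_def interp_less_limit strict_mono_dyadic_below dyadic_below_less)

lemma split_line_pos: "0 < y \<Longrightarrow> w < split_line w y"
  using interp_less_limit[OF strict_mono_dyadic_below dyadic_below_less, of "- w" "- ln y"]
  by (simp add: split_line_def)

lemma split_line_less:
  assumes "y \<noteq> 0" "y' \<noteq> 0" "y < y'"
  shows "split_line w y < split_line w y'"
proof -
  consider "y' < 0" | "y < 0" "0 < y'" | "0 < y"
    using assms by linarith
  then show ?thesis
  proof cases
    case 1
    then show ?thesis
      using assms(3) strict_monoD[OF strict_mono_interp[OF strict_mono_dyadic_below]]
      by (simp add: split_line_def)
  next
    case 2
    then show ?thesis
      using split_line_neg[of y w] split_line_pos[of y' w] by linarith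
  next
    case 3
    then show ?thesis
      using assms(3) strict_monoD[OF strict_mono_interp[OF strict_mono_dyadic_below]]
      by (simp add: split_line_def)
  qed
qed

lemma split_line_surj:
  assumes "x \<noteq> w"
  shows "\<exists>y. y \<noteq> 0 \<and> split_line w y = x"
proof (cases "x < w")
  case True
  then obtain t where "interp (dyadic_below w) t = x"
    using dyadic_below_exceeds interp_surj[OF strict_mono_dyadic_below] by blast
  then show ?thesis
    by (intro exI[of _ "- exp (- t)"]) (simp add: split_line_def)
next
  case False
  then have "- x < - w"
    using assms by simp
  then obtain t where "interp (dyadic_below (- w)) t = - x"
    using dyadic_below_exceeds interp_surj[OF strict_mono_dyadic_below] by blast
  then show ?thesis
    by (intro exI[of _ "exp (- t)"]) (simp add: split_line_def)
qed

lemma split_line_measurable [measurable]: "(\<lambda>w. split_line w y) \<in> borel_measurable borel"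
  unfolding split_line_def by measurable

text \<open>For fixed \<open>y\<close>, the argument of \<open>interp\<close> on either branch is
  fixed; only the rational nodes vary with \<open>w\<close>.\<close>

lemma countable_split_line_values: "countable (range (\<lambda>w. split_line w y))"
proof (rule countable_subset)
  let ?C = "\<lambda>t. {interp a t |a. range a \<subseteq> \<rat>}"
  show "range (\<lambda>w. split_line w y) \<subseteq> ?C (- ln (- y)) \<union> uminus ` ?C (- ln y)"
    using dyadic_below_rat by (fastforce simp: split_line_def)
  show "countable (?C (- ln (- y)) \<union> uminus ` ?C (- ln y))"
    by (intro countable_Un countable_image countable_interp_values)
qed

text \<open>These \<open>y\<close> are the only values that the inverse maps can take at
  \<open>x\<close> when \<open>w \<noteq> x\<close>, so the image of the constant \<open>x\<close>
  has countably many values a.e.\<close>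

lemma countable_split_line_arguments: "countable {y. y \<noteq> 0 \<and> (\<exists>w. split_line w y = x)}"
proof (rule countable_subset)
  let ?T = "\<lambda>x. {t. \<exists>a. strict_mono a \<and> range a \<subseteq> \<rat> \<and> interp a t = x}"
  show "countable ((\<lambda>t. - exp (- t)) ` ?T x \<union> (\<lambda>t. exp (- t)) ` ?T (- x))"
    by (intro countable_Un countable_image countable_interp_arguments)
  show "{y. y \<noteq> 0 \<and> (\<exists>w. split_line w y = x)} \<subseteq>
      (\<lambda>t. - exp (- t)) ` ?T x \<union> (\<lambda>t. exp (- t)) ` ?T (- x)"
  proof safe
    fix y w assume y: "y \<noteq> 0" "y \<notin> (\<lambda>t. exp (- t)) ` ?T (- split_line w y)"
    have "y < 0"
    proof (rule ccontr)
      assume "\<not> y < 0"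
      then have "y = exp (- (- ln y))"
        and "interp (dyadic_below (- w)) (- ln y) = - split_line w y"
        using y(1) by (auto simp: split_line_def)
      then show False
        using y(2) strict_mono_dyadic_below dyadic_below_rat by blast
    qed
    then have "y = - exp (- (- ln (- y)))"
      and "interp (dyadic_below w) (- ln (- y)) = split_line w y"
      by (auto simp: split_line_def)
    then show "y \<in> (\<lambda>t. - exp (- t)) ` ?T (split_line w y)"
      using strict_mono_dyadic_below dyadic_below_rat by blast
  qed
qed

lemma split_line_eq_iff:
  "y \<noteq> 0 \<Longrightarrow> y' \<noteq> 0 \<Longrightarrow> split_line w y = split_line w y' \<longleftrightarrow> y = y'"
  using split_line_less[of y y' w] split_line_less[of y' y w] by (cases y y' rule: linorder_cases) auto

lemma split_line_neq: "y \<noteq> 0 \<Longrightarrow> split_line w y \<noteq> w"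
  using split_line_neg[of y w] split_line_pos[of y w] by linarith

text \<open>The point \<open>w\<close> itself has no place in the image of \<open>split_line w\<close>; the value 1 is arbitrary.\<close>

definition merge_line :: "real \<Rightarrow> real \<Rightarrow> real" where
  "merge_line w x = (if x = w then 1 else (SOME y. y \<noteq> 0 \<and> split_line w y = x))"

lemma split_line_merge_line:
  assumes "x \<noteq> w"
  shows "merge_line w x \<noteq> 0 \<and> split_line w (merge_line w x) = x"
  using someI_ex[OF split_line_surj[OF assms]] assms by (simp add: merge_line_def)

lemma merge_line_nonzero: "merge_line w x \<noteq> 0"
  using split_line_merge_line[of x w] by (cases "x = w") (simp_all add: merge_line_def)

text \<open>Turns level sets of \<open>merge_line\<close>, which is defined by choice, into level
  sets of \<open>split_line\<close>, whose measurability in \<open>w\<close> is known.\<close>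

lemma merge_line_eq_iff:
  assumes "x \<noteq> w" "y \<noteq> 0"
  shows "merge_line w x = y \<longleftrightarrow> split_line w y = x"
  using split_line_merge_line[OF assms(1)] split_line_eq_iff[of "merge_line w x" y w] assms(2)
  by auto

lemma merge_line_less:
  assumes "x \<noteq> w" "x' \<noteq> w" "x < x'"
  shows "merge_line w x < merge_line w x'"
proof (rule ccontr)
  define y y' where "y = merge_line w x" and "y' = merge_line w x'"
  have y: "y \<noteq> 0" "split_line w y = x" and y': "y' \<noteq> 0" "split_line w y' = x'"
    using split_line_merge_line assms(1,2) by (auto simp: y_def y'_def)
  assume "\<not> merge_line w x < merge_line w x'"
  then have "y' = y \<or> y' < y"
    by (auto simp: y_def y'_def)
  then show False
    using split_line_less[of y' y w] y y' assms(3) by auto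
qed

section \<open>Images of constants as sections over Lebesgue measure\<close>

lemma complete_lebesgue_on:
  assumes "S \<in> sets lebesgue"
  shows "complete_measure (lebesgue_on S)"
proof
  fix A B assume "B \<subseteq> A" "A \<in> null_sets (lebesgue_on S)"
  then have "A \<subseteq> S" "A \<in> null_sets lebesgue"
    using assms by (auto simp: null_sets_restrict_space)
  then have "B \<in> sets lebesgue"
    using \<open>B \<subseteq> A\<close> completion.complete by blast
  then show "B \<in> sets (lebesgue_on S)"
    using \<open>B \<subseteq> A\<close> \<open>A \<subseteq> S\<close> assms by (auto simp: sets_restrict_space_iff)
qed

lemma AE_lebesgue_on_neq:
  fixes x :: real
  assumes "S \<in> sets lebesgue"
  shows "AE w in lebesgue_on S. x \<noteq> w"
proof -
  have "AE w in lborel. x \<noteq> w"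
    using AE_lborel_singleton[of x] by eventually_elim auto
  then have "AE w in lebesgue. x \<noteq> w"
    by (rule AE_completion)
  then show ?thesis
    using assms by (subst AE_restrict_space_iff) (auto elim: AE_mp)
qed

lemma split_line_level_sets:
  "{w \<in> space (lebesgue_on S). split_line w y = x} \<in> sets (lebesgue_on S)"
proof -
  have "(\<lambda>w. split_line w y) \<in> borel_measurable (lebesgue_on S)"
    by (intro measurable_restrict_space1 measurable_completion) simp
  then show ?thesis
    by measurable
qed

lemma split_line_section:
  assumes "S \<in> sets lebesgue"
  shows "measurable_section (lebesgue_on S) (discrete_structure UNIV R)
    (\<lambda>w\<in>space (lebesgue_on S). split_line w y)"
proof -
  interpret complete_measure "lebesgue_on S"
    using assms by (rule complete_lebesgue_on)
  let ?C = "range (\<lambda>w. split_line w y)"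
  let ?f = "\<lambda>w\<in>space (lebesgue_on S). split_line w y"
  have AE: "AE w in lebesgue_on S. ?f w \<in> ?C"
    using AE_space by eventually_elim simp
  have "?f \<in> lebesgue_on S \<rightarrow>\<^sub>M count_space UNIV"
  proof (rule measurable_AE_countable[OF countable_split_line_values AE])
    fix c
    have "{w \<in> space (lebesgue_on S). ?f w = c} = {w \<in> space (lebesgue_on S). split_line w y = c}"
      by auto
    then show "{w \<in> space (lebesgue_on S). ?f w = c} \<in> sets (lebesgue_on S)"
      using split_line_level_sets[of S y c] by simp
  qed
  then show ?thesis
    unfolding measurable_section_discrete_iff
    using AE countable_split_line_values by (intro conjI exI[of _ ?C]) auto
qed

text \<open>The arbitrary value of \<open>merge_line\<close> matters only at the single point
  \<open>w = x\<close>, a null set; elsewhere the values are countable in number and the level sets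
  are those of \<open>split_line\<close>.\<close>

lemma merge_line_section:
  assumes "S \<in> sets lebesgue"
  shows "measurable_section (lebesgue_on S) (discrete_structure (UNIV - {0}) R)
    (\<lambda>w\<in>space (lebesgue_on S). merge_line w x)"
proof -
  interpret complete_measure "lebesgue_on S"
    using assms by (rule complete_lebesgue_on)
  let ?C = "{y. y \<noteq> 0 \<and> (\<exists>w. split_line w y = x)}"
  let ?f = "\<lambda>w\<in>space (lebesgue_on S). merge_line w x"
  have AE: "AE w in lebesgue_on S. ?f w \<in> ?C"
    using AE_space AE_lebesgue_on_neq[OF assms, of x]
    by eventually_elim (auto dest: split_line_merge_line)
  have "?f \<in> lebesgue_on S \<rightarrow>\<^sub>M count_space UNIV"
  proof (rule measurable_AE_countable[OF countable_split_line_arguments AE])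
    fix y assume y: "y \<in> ?C"
    show "{w \<in> space (lebesgue_on S). ?f w = y} \<in> sets (lebesgue_on S)"
    proof (rule in_sets_AE)
      show "{w \<in> space (lebesgue_on S). split_line w y = x} \<in> sets (lebesgue_on S)"
        by (rule split_line_level_sets)
      show "AE w in lebesgue_on S. w \<in> {w \<in> space (lebesgue_on S). split_line w y = x} \<longleftrightarrow>
          w \<in> {w \<in> space (lebesgue_on S). ?f w = y}"
        using AE_lebesgue_on_neq[OF assms, of x]
        by eventually_elim (use y in \<open>auto simp: merge_line_eq_iff\<close>)
    qed simp
  qed
  then show ?thesis
    unfolding measurable_section_discrete_iff
    using AE countable_split_line_arguments merge_line_nonzero by (intro conjI exI[of _ ?C]) auto
qed

section \<open>Non-isomorphism of the two orders\<close>

text \<open>Dedekind completeness separates the orders: the preimage of the negative numbers would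
  have a supremum \<open>s\<close>, but its image \<open>h s\<close> is nonzero and so cannot fill
  the cut at 0.\<close>

lemma not_isomorphic_real_line_minus_zero:
  "\<not> isomorphic (discrete_structure UNIV ((<) :: real \<Rightarrow> real \<Rightarrow> bool))
     (discrete_structure (UNIV - {0 :: real}) (<))"
proof
  assume "isomorphic (discrete_structure UNIV ((<) :: real \<Rightarrow> real \<Rightarrow> bool))
    (discrete_structure (UNIV - {0 :: real}) (<))"
  then obtain h :: "real \<Rightarrow> real" where range: "range h = UNIV - {0}"
    and mless: "\<And>x y. (if h x < h y then 1 else 0 :: real) = (if x < y then 1 else 0)"
    unfolding isomorphic_def structure_iso_def discrete_structure_def by auto
  have less: "h x < h y \<longleftrightarrow> x < y" for x y
    using mless[of x y] by (auto split: if_splits)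
  have surj: "\<exists>x. h x = y" if "y \<noteq> 0" for y
    using range that by (metis DiffI UNIV_I empty_iff imageE insertE)
  define s where "s = Sup {x. h x < 0}"
  obtain a b where ab: "h a = -1" "h b = 1"
    using surj[of "-1"] surj[of 1] by auto
  have bdd: "bdd_above {x. h x < 0}"
    using less ab(2) by (intro bdd_aboveI[of _ b]) (smt (verit) mem_Collect_eq)
  have nonempty: "{x. h x < 0} \<noteq> {}"
    using ab(1) by (auto intro!: exI[of _ a])
  have "h s \<noteq> 0"
    using range by blast
  \<comment> \<open>Half of \<open>h s\<close> lies strictly between 0 and \<open>h s\<close>, so
    \<open>t\<close> contradicts the choice of \<open>s\<close> whichever sign \<open>h s\<close>
    has.\<close>
  then obtain t where t: "h t = h s / 2"
    using surj[of "h s / 2"] by auto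
  show False
  proof (cases "h s < 0")
    case True
    then have "s < t" "h t < 0"
      using less[of s t] t by auto
    then show False
      using cSup_upper[OF _ bdd, of t] by (simp add: s_def)
  next
    case False
    then have "t < s" "h t > 0"
      using less[of t s] t \<open>h s \<noteq> 0\<close> by auto
    then obtain u where "t < u" "h u < 0"
      using less_cSup_iff[OF nonempty bdd] by (auto simp: s_def)
    then show False
      using less[of t u] \<open>h t > 0\<close> by simp
  qed
qed

theorem corollary2:
  fixes M N :: "real metric_structure"
  defines "M \<equiv> discrete_structure UNIV (<)"
    and "N \<equiv> discrete_structure (UNIV - {0}) (<)"
  shows "\<not> isomorphic M N \<and>
         isomorphic (L1 (lebesgue_on {0..1::real}) M) (L1 (lebesgue_on {0..1::real}) N)"
proof
  show "\<not> isomorphic M N"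
    unfolding M_def N_def by (rule not_isomorphic_real_line_minus_zero)
  have S: "{0..1::real} \<in> sets lebesgue"
    by simp
  interpret complete_measure "lebesgue_on {0..1::real}"
    using S by (rule complete_lebesgue_on)
  let ?\<Omega> = "space (lebesgue_on {0..1::real})"
  show "isomorphic (L1 (lebesgue_on {0..1::real}) M) (L1 (lebesgue_on {0..1::real}) N)"
    unfolding M_def N_def
  \<comment> \<open>Over \<open>w\<close>, \<open>merge_line w\<close> closes the gap at
    \<open>w\<close> and moves it to 0, and \<open>split_line w\<close> is its inverse; a constant
    \<open>x\<close> meets the gap only at \<open>w = x\<close>.\<close>
  proof (rule isomorphic_L1_discreteI[OF merge_line_section[OF S] split_line_section[OF S]])
    fix y :: real assume y: "y \<in> UNIV - {0}"
    show "AE w in lebesgue_on {0..1}.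
        (\<lambda>v\<in>?\<Omega>. merge_line v ((\<lambda>v\<in>?\<Omega>. split_line v y) w)) w = y"
      using AE_space by eventually_elim (use y in \<open>simp add: merge_line_eq_iff split_line_neq\<close>)
  next
    fix x x' :: real
    \<comment> \<open>\<open>merge_line w\<close> is known to preserve the order only away from
      \<open>w\<close>, so the null event that \<open>w\<close> is \<open>x\<close> or
      \<open>x'\<close> is discarded first.\<close>
    have "AE w in lebesgue_on {0..1}. w \<in> ?\<Omega> \<and> x \<noteq> w \<and> x' \<noteq> w"
      using AE_space AE_lebesgue_on_neq[OF S, of x] AE_lebesgue_on_neq[OF S, of x']
      by eventually_elim simp
    then show "AE w in lebesgue_on {0..1}.
        (\<lambda>w\<in>?\<Omega>. merge_line w x) w = (\<lambda>w\<in>?\<Omega>. merge_line w x') w \<longleftrightarrow> x = x'"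
      and "AE w in lebesgue_on {0..1}.
        (\<lambda>w\<in>?\<Omega>. merge_line w x) w < (\<lambda>w\<in>?\<Omega>. merge_line w x') w \<longleftrightarrow> x < x'"
      by (eventually_elim, use merge_line_less[of x _ x'] merge_line_less[of x' _ x] in
        \<open>cases x x' rule: linorder_cases; force\<close>)+
  qed
qed

end
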